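(* Let $B$ be a nonempty set of sets, partially ordered by inclusion. Assume that $B$ satisfies (K2), i.e. for all $X_1\subset X_2$ in $B$ there exist $X_1\subseteq Y_1\subset Y_2\subseteq X_2$ in $B$ such that $Y_1,Y_2$ are immediate neighbors in $B$; and assume that for every nonempty chain $C\subseteq \mathrm{IS}(B)$, $\bigcup_{Z\in C}Z\in B$. Let $X$ be an element of $B$ which is not minimal. Then there exists a unique maximal (with respect to containment) nonempty initial subset $\mathcal I$ of $\mathrm{IS}(B)$ such that $X=\bigcup_{Y\in\mathcal I}Y$. Furthermore, $X=\bigcup_{Y\in E}Y$ for every maximal chain $E\subseteq\mathcal I$.
   Context: $\subset$ denotes proper inclusion. In a poset $S$, $a,b$ are immediate neighbors if $a<b$ and there is no $c\in S$ with $a<c<b$; then $a$ is an immediate predecessor of $b$. $\mathrm{IS}(S)$ is the set of elements of $S$ having an immediate predecessor in $S$, with the induced order. A subset $\mathcal I$ of a poset $S$ is initial if for every $\beta\in\mathcal I$ and $\alpha\in S$, $\alpha\le\beta$ implies $\alpha\in\mathcal I$. A chain is a totally ordered subset; a maximal chain $E\subseteq\mathcal I$ is a chain in $\mathcal I$ such that $E\cup\{x\}$ is not a chain for any $x\in\mathcal I\setminus E$. *)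

theory Defs
  imports Main
begin

text \<open>
  A poset is a set \<open>S\<close> of elements of a type of class \<^class>\<open>order\<close>, with the induced order.
  On sets, \<open>\<le>\<close> and \<open><\<close> are inclusion and proper inclusion.
\<close>

definition minimal_in :: "'a::order set \<Rightarrow> 'a \<Rightarrow> bool" where
  "minimal_in S x \<longleftrightarrow> x \<in> S \<and> \<not> (\<exists>y\<in>S. y < x)"

definition maximal_in :: "'a::order set \<Rightarrow> 'a \<Rightarrow> bool" where
  "maximal_in S x \<longleftrightarrow> x \<in> S \<and> \<not> (\<exists>y\<in>S. x < y)"

definition immediate_neighbors :: "'a::order set \<Rightarrow> 'a \<Rightarrow> 'a \<Rightarrow> bool" where
  "immediate_neighbors S a b \<longleftrightarrow> a \<in> S \<and> b \<in> S \<and> a < b \<and> \<not> (\<exists>c\<in>S. a < c \<and> c < b)"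

definition IS :: "'a::order set \<Rightarrow> 'a set" where
  "IS S = {b \<in> S. \<exists>a\<in>S. immediate_neighbors S a b}"

definition K2 :: "'a::order set \<Rightarrow> bool" where
  "K2 S \<longleftrightarrow> (\<forall>x1\<in>S. \<forall>x2\<in>S. x1 < x2 \<longrightarrow>
     (\<exists>y1\<in>S. \<exists>y2\<in>S. x1 \<le> y1 \<and> y1 < y2 \<and> y2 \<le> x2 \<and> immediate_neighbors S y1 y2))"

definition initial_in :: "'a::order set \<Rightarrow> 'a set \<Rightarrow> bool" where
  "initial_in S I \<longleftrightarrow> I \<subseteq> S \<and> (\<forall>\<beta>\<in>I. \<forall>\<alpha>\<in>S. \<alpha> \<le> \<beta> \<longrightarrow> \<alpha> \<in> I)"

definition chain_in :: "'a::order set \<Rightarrow> 'a set \<Rightarrow> bool" where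
  "chain_in S C \<longleftrightarrow> C \<subseteq> S \<and> Complete_Partial_Order.chain (\<le>) C"

definition maximal_chain_in :: "'a::order set \<Rightarrow> 'a set \<Rightarrow> bool" where
  "maximal_chain_in S E \<longleftrightarrow> chain_in S E \<and> (\<forall>x \<in> S - E. \<not> chain_in S (E \<union> {x}))"

end

theory Submission imports Defs begin

text \<open>
  The maximal initial set is \<open>M = {Y \<in> IS B. Y \<subseteq> X}\<close>, which contains every other candidate.  If the
  union \<open>U\<close> of a maximal chain of \<open>M\<close> were a proper subset of \<open>X\<close>, then (K2), applied to \<open>U \<subset> X\<close>,
  would give an element of \<open>M\<close> properly containing \<open>U\<close>, by which the chain could be extended.
  Maximal chains exist by Hausdorff's principle, hence \<open>\<Union>M = X\<close>.
\<close>

text \<open>A greatest element is the only maximal one, so existence and uniqueness of the maximal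
  initial set follow together.\<close>

lemma maximal_in_iff_greatest:
  assumes "m \<in> S" and "\<And>y. y \<in> S \<Longrightarrow> y \<le> m"
  shows "maximal_in S x \<longleftrightarrow> x = m"
  using assms unfolding maximal_in_def by (meson leD le_neq_trans)

lemma ex_maximal_chain_in: "\<exists>E. maximal_chain_in S E"
proof -
  have chain_iff: "pred_on.chain S (\<le>) C \<longleftrightarrow> chain_in S C" for C
    by (auto simp: pred_on.chain_def chain_in_def Complete_Partial_Order.chain_def)
  obtain E where "pred_on.maxchain S (\<le>) E"
    using pred_on.Hausdorff by blast
  \<comment> \<open>\<open>pred_on.maxchain\<close> excludes every proper superchain, in particular
    the one-point extensions.\<close>
  then have "maximal_chain_in S E"
    unfolding pred_on.maxchain_def maximal_chain_in_def chain_iff by blast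
  then show ?thesis ..
qed

lemma chain_in_mono: "chain_in S C \<Longrightarrow> S \<subseteq> T \<Longrightarrow> chain_in T C"
  unfolding chain_in_def by blast

lemma chain_in_Un_upper_bound:
  assumes "chain_in S C" and "x \<in> S" and "\<And>y. y \<in> C \<Longrightarrow> y \<le> x"
  shows "chain_in S (C \<union> {x})"
  using assms unfolding chain_in_def Complete_Partial_Order.chain_def by auto

lemma maximal_chain_in_upper_bound:
  assumes "maximal_chain_in S E" and "x \<in> S" and "\<And>y. y \<in> E \<Longrightarrow> y \<le> x"
  shows "x \<in> E"
  using assms chain_in_Un_upper_bound[of S E x] unfolding maximal_chain_in_def by blast

text \<open>Every element of \<open>S\<close> is vacuously an upper bound of the empty chain, so it
  would have to belong to it.\<close>

lemma maximal_chain_in_nonempty: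
  assumes "maximal_chain_in S E" and "S \<noteq> {}"
  shows "E \<noteq> {}"
  using assms maximal_chain_in_upper_bound[OF assms(1)] by blast

text \<open>The upper one of the two neighbors given by (K2) works: it has the lower one as
  immediate predecessor, and that one is above or equal to \<open>x\<close>.\<close>

lemma K2_ex_IS:
  assumes "K2 S" and "x \<in> S" and "y \<in> S" and "x < y"
  obtains z where "z \<in> IS S" and "x < z" and "z \<le> y"
proof -
  obtain y1 y2 where "y1 \<in> S" "y2 \<in> S" "x \<le> y1" "y1 < y2" "y2 \<le> y" "immediate_neighbors S y1 y2"
    using assms unfolding K2_def by blast
  then show ?thesis
    by (intro that[of y2]) (auto simp: IS_def)
qed

lemma initial_in_below: "initial_in S {y \<in> S. y \<le> x}"
  unfolding initial_in_def by auto

lemma Union_maximal_chain_below: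
  fixes B :: "'a set set"
  assumes "K2 B"
    and Union_chain: "\<And>C. chain_in (IS B) C \<Longrightarrow> C \<noteq> {} \<Longrightarrow> \<Union>C \<in> B"
    and "X \<in> B"
    and nonempty: "{Y \<in> IS B. Y \<le> X} \<noteq> {}"
    and E: "maximal_chain_in {Y \<in> IS B. Y \<le> X} E"
  shows "\<Union>E = X"
proof (rule ccontr)
  assume "\<Union>E \<noteq> X"
  have chain: "chain_in {Y \<in> IS B. Y \<le> X} E"
    using E unfolding maximal_chain_in_def by blast
  then have "\<Union>E \<subseteq> X"
    unfolding chain_in_def by blast
  with \<open>\<Union>E \<noteq> X\<close> have "\<Union>E \<subset> X"
    by blast
  \<comment> \<open>(K2) compares elements of \<open>B\<close> only, so the union must first be
    placed there; for this \<open>E\<close> has to be a nonempty chain of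
    \<open>IS B\<close>.\<close>
  moreover have "\<Union>E \<in> B"
    using chain_in_mono[OF chain] maximal_chain_in_nonempty[OF E nonempty]
    by (intro Union_chain) auto
  ultimately obtain Z where "Z \<in> IS B" "\<Union>E \<subset> Z" "Z \<subseteq> X"
    using K2_ex_IS[OF \<open>K2 B\<close> _ \<open>X \<in> B\<close>] by blast
  \<comment> \<open>\<open>Z\<close> is an upper bound of \<open>E\<close>, so maximality puts it
    into \<open>E\<close>, and then \<open>Z\<close> is contained in the union.\<close>
  then have "Z \<in> E"
    by (intro maximal_chain_in_upper_bound[OF E]) auto
  with \<open>\<Union>E \<subset> Z\<close> show False
    by blast
qed

theorem theorem2p3:
  fixes B :: "'a set set" and X :: "'a set"
  assumes "B \<noteq> {}"
    and "K2 B"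
    and "\<And>C. chain_in (IS B) C \<Longrightarrow> C \<noteq> {} \<Longrightarrow> (\<Union>Z\<in>C. Z) \<in> B"
    and "X \<in> B"
    and "\<not> minimal_in B X"
  shows "(\<exists>!I. maximal_in {J. initial_in (IS B) J \<and> J \<noteq> {} \<and> X = (\<Union>Y\<in>J. Y)} I) \<and>
    (\<forall>I. maximal_in {J. initial_in (IS B) J \<and> J \<noteq> {} \<and> X = (\<Union>Y\<in>J. Y)} I \<longrightarrow>
      (\<forall>E. maximal_chain_in I E \<longrightarrow> X = (\<Union>Y\<in>E. Y)))"
proof -
  define M where "M = {Y \<in> IS B. Y \<le> X}"
  let ?F = "{J. initial_in (IS B) J \<and> J \<noteq> {} \<and> X = (\<Union>Y\<in>J. Y)}"
  \<comment> \<open>Non-minimality of \<open>X\<close> enters here: (K2) between \<open>W\<close>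
    and \<open>X\<close> yields an element of \<open>M\<close>.\<close>
  obtain W where "W \<in> B" "W < X"
    using assms(4,5) unfolding minimal_in_def by blast
  then obtain Z where "Z \<in> IS B" "Z \<le> X"
    using K2_ex_IS[OF assms(2) _ assms(4)] by metis
  then have "M \<noteq> {}"
    unfolding M_def by blast
  then have chains: "\<Union>E = X" if "maximal_chain_in M E" for E
    using assms(3) \<open>M \<noteq> {}\<close> that unfolding M_def
    by (intro Union_maximal_chain_below[OF assms(2) _ assms(4)]) simp_all
  obtain E where E: "maximal_chain_in M E"
    using ex_maximal_chain_in by blast
  then have "E \<subseteq> M"
    unfolding maximal_chain_in_def chain_in_def by blast
  then have "X \<subseteq> \<Union>M"
    using chains[OF E] by blast
  moreover have "\<Union>M \<subseteq> X"
    unfolding M_def by blast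
  ultimately have "M \<in> ?F"
    using \<open>M \<noteq> {}\<close> initial_in_below[of "IS B" X] unfolding M_def by auto
  \<comment> \<open>Each member of \<open>J\<close> lies below the union of \<open>J\<close>, which
    is \<open>X\<close>.\<close>
  moreover have "J \<subseteq> M" if "J \<in> ?F" for J
    using that unfolding M_def initial_in_def by blast
  ultimately have "maximal_in ?F I \<longleftrightarrow> I = M" for I
    by (rule maximal_in_iff_greatest)
  then show ?thesis
    using chains by auto
qed

end
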